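(* Let $p$ be a prime, let $V_{p-1}=\{\mathbf{0},\mathbf{e}_1,\dots,\mathbf{e}_{p-1}\}\subset\mathbb{Z}^{p-1}$, and let $\{V_{p-1}+l : l\in\mathcal{L}\}$ be a tiling of $\mathbb{Z}^{p-1}$ by translates of $V_{p-1}$. Let $T:\mathbb{Z}[x_1^{\pm1},\dots,x_{p-1}^{\pm1}]\to\mathbb{Z}$ be the $\mathbb{Z}$-linear map with $T(x_1^{a_1}\cdots x_{p-1}^{a_{p-1}})=1$ if $(a_1,\dots,a_{p-1})\in\mathcal{L}$ and $0$ otherwise. Then for every integer $k$ with $0\le k<p$, \[T\Big(\sum_{i_1<\dots<i_k}x_{i_1}x_{i_2}\cdots x_{i_k}\Big)=\frac{\binom{p-1}{k}-(-1)^k}{p}+(-1)^kT(1).\] Equivalently, the number of elements of $\mathcal{L}$ that are $0/1$-vectors with exactly $k$ coordinates equal to $1$ is $\frac1p\big(\binom{p-1}{k}+(p-1)(-1)^k\big)$ if $\mathbf{0}\in\mathcal{L}$, and $\frac1p\big(\binom{p-1}{k}-(-1)^k\big)$ if $\mathbf{0}\notin\mathcal{L}$.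
   Context: A tiling of $\mathbb{Z}^{m}$ by translates of $V$ is a family $\{V+l: l\in\mathcal{L}\}$ such that every $x\in\mathbb{Z}^m$ can be written uniquely as $x=v+l$ with $v\in V$, $l\in\mathcal{L}$. $\mathbf{e}_i$ is the $i$-th standard basis vector. *)

theory Defs
  imports
    "HOL-Analysis.Finite_Cartesian_Product"
    "HOL-Library.Poly_Mapping"
    "HOL-Computational_Algebra.Primes"
begin

definition tiling :: "'a::plus set \<Rightarrow> 'a set \<Rightarrow> bool" where
  "tiling V L \<longleftrightarrow> (\<forall>x. \<exists>!p. p \<in> V \<times> L \<and> x = fst p + snd p)"

definition corner :: "(int ^ 'n::finite) set" where
  "corner = insert 0 (range (\<lambda>i. axis i 1))"

text \<open>Laurent polynomials over the integers are the group ring of the exponent group: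
  the product of \<^typ>\<open>('a \<Rightarrow>\<^sub>0 'b)\<close> is the convolution product, so that
  \<^term>\<open>Poly_Mapping.single a 1\<close> is the monomial with exponent vector \<open>a\<close>.\<close>

type_synonym 'n laurent = "(int ^ 'n) \<Rightarrow>\<^sub>0 int"

definition lmonom :: "int ^ 'n::finite \<Rightarrow> 'n laurent" where
  "lmonom a = Poly_Mapping.single a 1"

definition lvar :: "'n::finite \<Rightarrow> 'n laurent" where
  "lvar i = lmonom (axis i 1)"

abbreviation Z_linear :: "('n::finite laurent \<Rightarrow> int) \<Rightarrow> bool" where
  "Z_linear \<equiv> module_hom (\<lambda>c f. of_int c * f) (*)"

definition elem_sym :: "nat \<Rightarrow> 'n::finite laurent" where
  "elem_sym k = (\<Sum>I | card I = k. \<Prod>i\<in>I. lvar i)"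

lemma lmonom_0: "lmonom 0 = 1"
  by (simp add: lmonom_def)

lemma lmonom_add: "lmonom (a + b) = lmonom a * lmonom (b :: int ^ 'n::finite)"
  by (simp add: lmonom_def mult_single)

lemma ex_Z_linear:
  fixes L :: "(int ^ 'n::finite) set"
  shows "\<exists>T. Z_linear T \<and> (\<forall>a. T (lmonom a) = (if a \<in> L then 1 else 0))"
proof -
  define T :: "'n laurent \<Rightarrow> int"
    where "T f = (\<Sum>a\<in>Poly_Mapping.keys f. Poly_Mapping.lookup f a * of_bool (a \<in> L))" for f
  have T_eq: "T f = (\<Sum>a\<in>A. Poly_Mapping.lookup f a * of_bool (a \<in> L))"
    if "finite A" "Poly_Mapping.keys f \<subseteq> A" for f A
    unfolding T_def using that by (intro sum.mono_neutral_left) (auto simp: not_in_keys_iff_lookup_eq_zero)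
  have scale: "Poly_Mapping.lookup (of_int c * f) a = c * Poly_Mapping.lookup f a" for c a and f :: "'n laurent"
  proof -
    have "of_int c * f = Poly_Mapping.map ((*) c) f"
      using mult_map_scale_conv_mult[of c f] single_of_int[of c, where ?'a = "int ^ 'n" and ?'b = int]
      by simp
    then show ?thesis
      by (simp add: Poly_Mapping.map.rep_eq when_def)
  qed
  have "T (f + g) = T f + T g" for f g
  proof -
    let ?A = "Poly_Mapping.keys f \<union> Poly_Mapping.keys g"
    have "T (f + g) = (\<Sum>a\<in>?A. Poly_Mapping.lookup (f + g) a * of_bool (a \<in> L))"
      by (rule T_eq) (auto simp: in_keys_iff lookup_add)
    then show ?thesis
      using T_eq[of ?A f] T_eq[of ?A g]
      by (simp add: lookup_add distrib_right sum.distrib)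
  qed
  moreover have "T (of_int c * f) = c * T f" for c f
  proof -
    have "T (of_int c * f) =
        (\<Sum>a\<in>Poly_Mapping.keys f. Poly_Mapping.lookup (of_int c * f) a * of_bool (a \<in> L))"
      by (rule T_eq) (auto simp: in_keys_iff scale)
    then show ?thesis
      by (simp only: scale T_def[of f] sum_distrib_left mult.assoc)
  qed
  ultimately have "Z_linear T"
    by unfold_locales (simp_all add: algebra_simps)
  moreover have "T (lmonom a) = (if a \<in> L then 1 else 0)" for a
    by (simp add: T_def lmonom_def)
  ultimately show ?thesis by blast
qed

end

theory Submission
  imports Defs "HOL-Number_Theory.Residues"
begin

text \<open>
  Let \<open>f\<^sub>j\<close> be the sum of the monomials with exponents \<open>-j v\<close>, for \<open>v\<close> in the tile. Tiling means
  \<open>T (g f\<^sub>1) = g(1)\<close> for all \<open>g\<close>, and a Frobenius argument extends this to \<open>T (g f\<^sub>j) = g(1)\<close> for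
  all \<open>j\<close> prime to \<open>p\<close>. Hence \<open>U g = p T g - g(1)\<close> vanishes on the ideal generated by the
  \<open>f\<^sub>j = 1 + \<Sum>\<^sub>i x\<^sub>i\<^sup>-\<^sup>j\<close> with \<open>0 < j < p\<close>, and Newton's identities show that modulo this ideal,
  up to torsion, the elementary symmetric polynomials in the \<open>x\<^sub>i\<^sup>-\<^sup>1\<close> are \<open>(-1)\<^sup>k\<close>. Multiplying by
  \<open>x\<^sub>1 \<cdots> x\<^sub>p\<^sub>-\<^sub>1\<close> turns this into \<open>U e\<^sub>k = (-1)\<^sup>k U 1\<close>.
\<close>

section \<open>Newton's identities\<close>

definition esym :: "('i \<Rightarrow> 'a::comm_ring_1) \<Rightarrow> 'i set \<Rightarrow> nat \<Rightarrow> 'a" where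
  "esym y A k = (\<Sum>I | I \<subseteq> A \<and> card I = k. \<Prod>i\<in>I. y i)"

lemma esym_0: "finite A \<Longrightarrow> esym y A 0 = 1"
proof -
  assume "finite A"
  then have "{I. I \<subseteq> A \<and> card I = 0} = {{}}"
    by (auto dest: finite_subset)
  then show ?thesis by (simp add: esym_def)
qed

lemma sum_esym_containing:
  assumes "finite A" "i \<in> A"
  shows "(\<Sum>I | I \<subseteq> A \<and> card I = Suc k \<and> i \<in> I. \<Prod>j\<in>I. y j) = y i * esym y (A - {i}) k"
proof -
  have "(\<Sum>I | I \<subseteq> A \<and> card I = Suc k \<and> i \<in> I. \<Prod>j\<in>I. y j)
      = (\<Sum>I | I \<subseteq> A - {i} \<and> card I = k. \<Prod>j\<in>insert i I. y j)"
  proof (rule sum.reindex_bij_witness[of _ "insert i" "\<lambda>I. I - {i}"])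
    fix I assume "I \<in> {I. I \<subseteq> A - {i} \<and> card I = k}"
    moreover from this have "finite I" using assms(1) by (auto dest: finite_subset)
    ultimately show "insert i I \<in> {I. I \<subseteq> A \<and> card I = Suc k \<and> i \<in> I}"
      using assms by (subst mem_Collect_eq, subst card_insert_disjoint) auto
  qed (auto simp: insert_absorb card_Diff_singleton)
  also have "\<dots> = (\<Sum>I | I \<subseteq> A - {i} \<and> card I = k. y i * (\<Prod>j\<in>I. y j))"
  proof (rule sum.cong[OF refl])
    fix I assume "I \<in> {I. I \<subseteq> A - {i} \<and> card I = k}"
    moreover from this have "finite I" using assms(1) by (auto dest: finite_subset)
    ultimately show "(\<Prod>j\<in>insert i I. y j) = y i * (\<Prod>j\<in>I. y j)"
      by (subst prod.insert) auto
  qed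
  finally show ?thesis by (simp add: esym_def sum_distrib_left)
qed

lemma esym_remove:
  assumes "finite A" "i \<in> A"
  shows "esym y A (Suc k) = esym y (A - {i}) (Suc k) + y i * esym y (A - {i}) k"
proof -
  have "{I. I \<subseteq> A \<and> card I = Suc k}
      = {I. I \<subseteq> A - {i} \<and> card I = Suc k} \<union> {I. I \<subseteq> A \<and> card I = Suc k \<and> i \<in> I}"
    by auto
  then have "esym y A (Suc k) = esym y (A - {i}) (Suc k)
      + (\<Sum>I | I \<subseteq> A \<and> card I = Suc k \<and> i \<in> I. \<Prod>j\<in>I. y j)"
    unfolding esym_def using assms(1)
    by (simp only:) (rule sum.union_disjoint, auto)
  then show ?thesis using sum_esym_containing[OF assms] by simp
qed

text \<open>Unrolls the recursion of \<open>esym_remove\<close>. In generating functions, deleting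
  \<open>i\<close> divides by the factor \<open>1 + y i * t\<close>, and the powers of
  \<open>- y i\<close> are the geometric series of its inverse.\<close>

lemma esym_remove_eq_sum:
  assumes "finite A" "i \<in> A"
  shows "esym y (A - {i}) k = (\<Sum>m\<le>k. (- y i) ^ m * esym y A (k - m))"
proof (induction k)
  case 0
  then show ?case using assms by (simp add: esym_0)
next
  case (Suc k)
  have "(\<Sum>m\<le>Suc k. (- y i) ^ m * esym y A (Suc k - m))
      = esym y A (Suc k) + (\<Sum>m\<le>k. (- y i) ^ Suc m * esym y A (k - m))"
    by (subst sum.atMost_Suc_shift) simp
  also have "\<dots> = esym y A (Suc k) - y i * esym y (A - {i}) k"
    by (simp add: Suc.IH sum_distrib_left sum_negf mult.assoc)
  finally show ?case using esym_remove[OF assms, of y k] by simp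
qed

text \<open>Double counting of the pairs \<open>(i, I)\<close> with \<open>i \<in> I\<close>: each
  \<open>I\<close> of size \<open>Suc k\<close> occurs once for each of its elements.\<close>

lemma Suc_mult_esym:
  assumes "finite A"
  shows "of_nat (Suc k) * esym y A (Suc k) = (\<Sum>i\<in>A. y i * esym y (A - {i}) k)"
proof -
  have "(\<Sum>i\<in>A. y i * esym y (A - {i}) k)
      = (\<Sum>i\<in>A. \<Sum>I | I \<in> {I. I \<subseteq> A \<and> card I = Suc k} \<and> i \<in> I. \<Prod>j\<in>I. y j)"
    by (rule sum.cong) (simp_all add: sum_esym_containing[OF assms, symmetric] conj_assoc)
  also have "\<dots> = (\<Sum>I | I \<subseteq> A \<and> card I = Suc k. \<Sum>i | i \<in> A \<and> i \<in> I. \<Prod>j\<in>I. y j)"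
    using assms by (intro sum.swap_restrict) auto
  also have "\<dots> = (\<Sum>I | I \<subseteq> A \<and> card I = Suc k. of_nat (Suc k) * (\<Prod>j\<in>I. y j))"
  proof (rule sum.cong[OF refl])
    fix I assume I: "I \<in> {I. I \<subseteq> A \<and> card I = Suc k}"
    then have "{i. i \<in> A \<and> i \<in> I} = I" by auto
    then show "(\<Sum>i | i \<in> A \<and> i \<in> I. \<Prod>j\<in>I. y j) = of_nat (Suc k) * (\<Prod>j\<in>I. y j)"
      using I by simp
  qed
  finally show ?thesis by (simp add: esym_def sum_distrib_left)
qed

lemma newton_identity:
  assumes "finite A"
  shows "of_nat (Suc k) * esym y A (Suc k)
    = (\<Sum>m\<le>k. (-1) ^ m * (\<Sum>i\<in>A. y i ^ Suc m) * esym y A (k - m))"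
proof -
  have "of_nat (Suc k) * esym y A (Suc k)
      = (\<Sum>i\<in>A. \<Sum>m\<le>k. (-1) ^ m * y i ^ Suc m * esym y A (k - m))"
    unfolding Suc_mult_esym[OF assms]
  proof (rule sum.cong[OF refl])
    fix i assume "i \<in> A"
    have "y i * (- y i) ^ m = (-1) ^ m * y i ^ Suc m" for m
      by (subst power_minus) (simp add: ac_simps)
    then show "y i * esym y (A - {i}) k = (\<Sum>m\<le>k. (-1) ^ m * y i ^ Suc m * esym y A (k - m))"
      by (simp add: esym_remove_eq_sum[OF assms \<open>i \<in> A\<close>] sum_distrib_left mult.assoc[symmetric])
  qed
  also have "\<dots> = (\<Sum>m\<le>k. (-1) ^ m * (\<Sum>i\<in>A. y i ^ Suc m) * esym y A (k - m))"
    by (subst sum.swap) (simp add: sum_distrib_left sum_distrib_right)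
  finally show ?thesis .
qed

text \<open>If \<open>U\<close> cannot distinguish the first \<open>n\<close> power sums from \<open>-1\<close>, then by Newton's identities
  it sees \<open>y\<close> as the non-trivial \<open>(n+1)\<close>-th roots of unity.\<close>

lemma additive_esym_eq:
  fixes y :: "'i \<Rightarrow> 'a::comm_ring_1" and U :: "'a \<Rightarrow> int"
  assumes "finite A" and add: "\<And>g h. U (g + h) = U g + U h"
    and pow: "\<And>g j. 0 < j \<Longrightarrow> j \<le> n \<Longrightarrow> U (g * (1 + (\<Sum>i\<in>A. y i ^ j))) = 0"
    and "k \<le> n"
  shows "U (g * esym y A k) = (-1) ^ k * U g"
  using \<open>k \<le> n\<close>
proof (induction k arbitrary: g rule: less_induct)
  case (less k)
  interpret U: additive U by unfold_locales (rule add)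
  have sgn: "U ((-1) ^ m * h) = (-1) ^ m * U h" for m h
    by (cases "even m") (simp_all add: U.minus)
  have of_nat: "U (of_nat m * h) = int m * U h" for m h
    by (induction m) (simp_all add: U.zero add distrib_right)
  show ?case
  proof (cases k)
    case 0
    then show ?thesis by (simp add: esym_0[OF \<open>finite A\<close>])
  next
    case (Suc r)
    have summand: "U (g * ((-1) ^ m * (\<Sum>i\<in>A. y i ^ Suc m) * esym y A (r - m))) = (-1) ^ k * U g"
      if "m \<le> r" for m
    proof -
      \<comment> \<open>The hypothesis holds for every multiplier, so the factor
        \<open>esym y A (r - m)\<close> can be absorbed into it.\<close>
      have "U (g * esym y A (r - m) * (1 + (\<Sum>i\<in>A. y i ^ Suc m))) = 0"
        using that Suc less.prems by (intro pow) auto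
      then have "U (g * esym y A (r - m) * (\<Sum>i\<in>A. y i ^ Suc m)) = - U (g * esym y A (r - m))"
        by (simp only: distrib_left add mult_1_right)
      also have "\<dots> = - ((-1) ^ (r - m) * U g)"
        using Suc less.prems that by (subst less.IH) auto
      finally have "U ((-1) ^ m * (g * esym y A (r - m) * (\<Sum>i\<in>A. y i ^ Suc m)))
          = - ((-1) ^ m * (-1) ^ (r - m)) * U g"
        by (simp only: sgn) simp
      also have "- ((-1) ^ m * (-1) ^ (r - m)) = ((-1) ^ k :: int)"
        using that Suc by (simp flip: power_add)
      finally show ?thesis by (simp only: ac_simps)
    qed
    have "int k * U (g * esym y A k) = U (g * (of_nat (Suc r) * esym y A (Suc r)))"
      using Suc of_nat[of k "g * esym y A k"] by (simp only: ac_simps)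
    also have "\<dots> = (\<Sum>m\<le>r. U (g * ((-1) ^ m * (\<Sum>i\<in>A. y i ^ Suc m) * esym y A (r - m))))"
      by (simp only: newton_identity[OF \<open>finite A\<close>] sum_distrib_left U.sum)
    also have "\<dots> = int k * ((-1) ^ k * U g)"
    proof -
      have "(\<Sum>m\<le>r. U (g * ((-1) ^ m * (\<Sum>i\<in>A. y i ^ Suc m) * esym y A (r - m))))
          = (\<Sum>m\<le>r. (-1) ^ k * U g)"
        by (rule sum.cong) (simp_all only: summand atMost_iff)
      then show ?thesis using Suc by simp
    qed
    \<comment> \<open>The factor \<open>k\<close> from Newton's identity is cancelled among the
      integer values of \<open>U\<close>; the ring itself may have torsion.\<close>
    finally show ?thesis
      unfolding mult_left_cancel[OF of_nat_neq_0[of r, folded Suc]] .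
  qed
qed

section \<open>Powers of sums modulo a prime\<close>

text \<open>The inner binomial coefficients are multiples of the prime \<open>q\<close>. The witness
  \<open>h\<close> expresses the congruence in an arbitrary commutative ring.\<close>

lemma prime_power_add_cong:
  fixes a b :: "'a::comm_ring_1"
  assumes "prime q"
  shows "\<exists>h. (a + b) ^ q = a ^ q + b ^ q + of_nat q * h"
proof -
  obtain r where r: "q = Suc (Suc r)"
    using prime_ge_2_nat[OF assms] by (metis add_2_eq_Suc le_Suc_ex)
  have "of_nat (q choose Suc i) = (of_nat q * of_nat ((q choose Suc i) div q) :: 'a)" if "i \<le> r" for i
  proof -
    have "q dvd (q choose Suc i)"
      using that r by (intro dvd_choose_prime assms) auto
    then show ?thesis by (metis dvd_mult_div_cancel of_nat_mult)
  qed
  then have "(\<Sum>i\<le>r. of_nat (q choose Suc i) * a ^ Suc i * b ^ (q - Suc i))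
      = of_nat q * (\<Sum>i\<le>r. of_nat ((q choose Suc i) div q) * a ^ Suc i * b ^ (q - Suc i))"
    unfolding sum_distrib_left by (intro sum.cong) (auto simp: mult.assoc)
  moreover have "(a + b) ^ q
      = b ^ q + (\<Sum>i\<le>r. of_nat (q choose Suc i) * a ^ Suc i * b ^ (q - Suc i)) + a ^ q"
    unfolding binomial_ring r
    by (subst sum.atMost_Suc_shift, subst sum.atMost_Suc) (simp del: binomial_Suc_Suc)
  ultimately show ?thesis by (auto simp: add_ac)
qed

lemma prime_power_sum_cong:
  fixes y :: "'i \<Rightarrow> 'a::comm_ring_1"
  assumes "prime q"
  shows "\<exists>h. (\<Sum>i\<in>A. y i) ^ q = (\<Sum>i\<in>A. y i ^ q) + of_nat q * h"
proof (induction A rule: infinite_finite_induct)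
  case (insert i A)
  from insert.IH obtain h where h: "(\<Sum>i\<in>A. y i) ^ q = (\<Sum>i\<in>A. y i ^ q) + of_nat q * h" ..
  obtain h' where "(y i + (\<Sum>i\<in>A. y i)) ^ q = y i ^ q + (\<Sum>i\<in>A. y i) ^ q + of_nat q * h'"
    using prime_power_add_cong[OF assms] by blast
  then have "(\<Sum>i\<in>insert i A. y i) ^ q = (\<Sum>i\<in>insert i A. y i ^ q) + of_nat q * (h + h')"
    using insert.hyps h by (simp add: algebra_simps)
  then show ?case ..
qed (use assms in \<open>auto simp: zero_power prime_gt_0_nat intro!: exI[of _ 0]\<close>)

section \<open>Linear functionals on Laurent polynomials\<close>

lemma Z_linear_add: "Z_linear T \<Longrightarrow> T (g + h) = T g + T h"
  by (rule module_hom.add)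

lemma Z_linear_sum: "Z_linear T \<Longrightarrow> T (\<Sum>i\<in>A. g i) = (\<Sum>i\<in>A. T (g i))"
  by (rule module_hom.sum)

lemma Z_linear_of_int_mult: "Z_linear T \<Longrightarrow> T (of_int c * g) = c * T g"
  by (rule module_hom.scale)

text \<open>Additively, Laurent polynomials form the free abelian group on their exponent
  vectors.\<close>

lemma laurent_induct [case_names zero lmonom diff]:
  fixes g :: "'n::finite laurent"
  assumes "P 0" "\<And>a. P (lmonom a)" "\<And>g h. P g \<Longrightarrow> P h \<Longrightarrow> P (g - h)"
  shows "P g"
  by (rule frag_induction[of g UNIV]) (use assms in \<open>simp_all add: lmonom_def\<close>)

lemma lmonom_sum: "finite A \<Longrightarrow> lmonom (\<Sum>i\<in>A. f i) = (\<Prod>i\<in>A. lmonom (f i))"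
  by (induction A rule: finite_induct) (simp_all add: lmonom_0 lmonom_add)

text \<open>Vectors multiply componentwise, so \<open>of_nat j\<close> is the constant vector and
  \<open>of_nat j * a\<close> is the dilate of \<open>a\<close>.\<close>

lemma lmonom_power: "lmonom a ^ j = lmonom (of_nat j * a)"
  by (induction j) (simp_all add: lmonom_0 lmonom_add distrib_right)

section \<open>Dilates of a tile\<close>

text \<open>The left side counts the \<open>v \<in> V\<close> with \<open>a - v \<in> L\<close>,
  that is, the representations of \<open>a\<close> in the tiling.\<close>

lemma tiling_lmonom_sum:
  fixes V L :: "(int ^ 'n::finite) set"
  assumes "finite V" "tiling V L" "Z_linear T"
    and T: "\<And>a. T (lmonom a) = (if a \<in> L then 1 else 0)"
  shows "T (lmonom a * (\<Sum>v\<in>V. lmonom (- v))) = 1"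
proof -
  have "T (lmonom a * (\<Sum>v\<in>V. lmonom (- v))) = (\<Sum>v\<in>V. if a - v \<in> L then 1 else 0)"
    using assms(3) by (simp add: sum_distrib_left Z_linear_sum T flip: lmonom_add)
  also have "\<dots> = int (card {v \<in> V. a - v \<in> L})"
    using assms(1) by (simp add: sum.If_cases Int_def)
  also have "card {v \<in> V. a - v \<in> L} = 1"
  proof -
    obtain v l where vl: "v \<in> V" "l \<in> L" "a = v + l"
      and uniq: "\<And>v' l'. v' \<in> V \<Longrightarrow> l' \<in> L \<Longrightarrow> a = v' + l' \<Longrightarrow> v' = v"
      using assms(2) unfolding tiling_def Ex1_def
      by (metis (no_types, lifting) SigmaE SigmaI fst_conv snd_conv)
    have "{v \<in> V. a - v \<in> L} = {v}"
      using vl uniq[of _ "a - _"] by (auto simp: algebra_simps)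
    then show ?thesis by simp
  qed
  finally show ?thesis by simp
qed

text \<open>For a prime \<open>q\<close>, raising the sum over the tile to the power \<open>q\<close> shows that the number of
  representations of any point by the \<open>q\<close>-fold dilate is congruent to \<open>1\<close> modulo \<open>q\<close>, hence
  positive; as these numbers add up to \<open>card V\<close> over any reflected translate of the tile, they all
  equal \<open>1\<close>.\<close>

lemma tiling_lmonom_sum_power:
  fixes V L :: "(int ^ 'n::finite) set"
  assumes "finite V" "tiling V L" "Z_linear T"
    and T: "\<And>a. T (lmonom a) = (if a \<in> L then 1 else 0)"
    and "0 < j" "coprime j (card V)"
  shows "T (lmonom a * (\<Sum>v\<in>V. lmonom (- v) ^ j)) = 1"
  using assms(5,6)
proof (induction j arbitrary: a rule: less_induct)
  case (less j)
  show ?case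
  proof (cases "j = 1")
    case True
    then show ?thesis using tiling_lmonom_sum[OF assms(1-3) T] by simp
  next
    case False
    \<comment> \<open>One prime factor is peeled off \<open>j\<close> at a time; the cofactor
      \<open>r\<close> is smaller and still prime to \<open>card V\<close>.\<close>
    then obtain q where q: "prime q" "q dvd j" using prime_factor_nat by blast
    then obtain r where j: "j = r * q" by (metis dvd_def mult.commute)
    define f where "f i = (\<Sum>v\<in>V. lmonom (- v) ^ i)" for i
    have IH: "T (lmonom a * f r) = 1" for a
      unfolding f_def using less.prems j prime_gt_1_nat[OF q(1)] by (intro less.IH) auto
    have f_mult: "T (lmonom a * f i * g) = (\<Sum>v\<in>V. T (lmonom (a + of_nat i * - v) * g))" for a i g
      unfolding f_def
      by (simp add: sum_distrib_left sum_distrib_right Z_linear_sum[OF assms(3)] lmonom_power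
        del: mult_minus_right flip: lmonom_add)
    \<comment> \<open>Expanding one factor \<open>f r\<close> gives \<open>card V\<close>
      translates, each with the value known for the lower power.\<close>
    have pow: "T (lmonom a * f r ^ Suc m) = int (card V) ^ m" for a m
    proof (induction m arbitrary: a)
      case (Suc m)
      have "T (lmonom a * f r ^ Suc (Suc m)) = T (lmonom a * f r * f r ^ Suc m)"
        by (simp add: ac_simps)
      then show ?case by (simp only: f_mult Suc.IH) simp
    qed (simp add: IH)
    have cong: "[T (lmonom a * f j) = 1] (mod int q)" for a
    proof -
      obtain h where "f r ^ q = f j + of_nat q * h"
        using prime_power_sum_cong[OF q(1), of "\<lambda>v. lmonom (- v) ^ r" V]
        unfolding f_def j power_mult by blast
      then have "lmonom a * f r ^ q = lmonom a * f j + of_int (int q) * (lmonom a * h)"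
        by (simp add: algebra_simps)
      then have "T (lmonom a * f j) = T (lmonom a * f r ^ q) - int q * T (lmonom a * h)"
        by (simp only: Z_linear_add[OF assms(3)] Z_linear_of_int_mult[OF assms(3)])
      also have "T (lmonom a * f r ^ q) = int (card V ^ (q - 1))"
        using pow[of a "q - 1"] prime_gt_0_nat[OF q(1)] by simp
      finally have "[T (lmonom a * f j) = int (card V ^ (q - 1))] (mod int q)"
        by (simp add: cong_iff_dvd_diff)
      moreover have "[card V ^ (q - 1) = 1] (mod q)"
      proof (rule fermat_theorem[OF q(1)])
        show "\<not> q dvd card V"
          using less.prems(2) q by (metis coprime_common_divisor_nat dvd_trans not_prime_1)
      qed
      then have "[int (card V ^ (q - 1)) = 1] (mod int q)"
        by (metis cong_int_iff of_nat_1)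
      ultimately show ?thesis by (rule cong_trans)
    qed
    \<comment> \<open>The value is a count, hence nonnegative, and being 1 modulo \<open>q\<close>
      it is not 0.\<close>
    have ge1: "1 \<le> T (lmonom a * f j)" for a
    proof -
      have "T (lmonom a * f j) = (\<Sum>v\<in>V. T (lmonom (a + of_nat j * - v)))"
        using f_mult[of a j 1] by simp
      then have "0 \<le> T (lmonom a * f j)"
        by (simp only:) (rule sum_nonneg, simp add: T)
      moreover have "T (lmonom a * f j) \<noteq> 0"
        using cong[of a] prime_gt_1_nat[OF q(1)] by (auto simp: cong_def)
      ultimately show ?thesis by simp
    qed
    \<comment> \<open>The product \<open>f r * f j\<close> is expanded in two ways: along
      \<open>f r\<close> it gives the left side, along \<open>f j\<close> each term is 1 by
      \<open>IH\<close>.\<close>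
    have total: "(\<Sum>v\<in>V. T (lmonom (b + of_nat r * - v) * f j)) = int (card V)" for b
    proof -
      have "(\<Sum>v\<in>V. T (lmonom (b + of_nat r * - v) * f j)) = T (lmonom b * f j * f r)"
        by (simp only: f_mult[symmetric]) (simp only: ac_simps)
      then show ?thesis by (simp only: f_mult IH) simp
    qed
    have "V \<noteq> {}"
      using assms(2) by (auto simp: tiling_def)
    then obtain w where "w \<in> V" by blast
    \<comment> \<open>Chosen so that the summand at \<open>w\<close> is the one at the given point
      \<open>a\<close>.\<close>
    define b where "b = a - of_nat r * - w"
    let ?c = "\<lambda>v. T (lmonom (b + of_nat r * - v) * f j)"
    have "(\<Sum>v\<in>V. ?c v - 1) = 0"
      using total[of b] by (simp add: sum_subtractf)
    then have "?c w - 1 = 0"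
      using \<open>finite V\<close> \<open>w \<in> V\<close> ge1
      by (subst (asm) sum_nonneg_eq_0_iff) (simp_all only: diff_ge_0_iff_ge)
    then show ?thesis by (simp add: b_def f_def)
  qed
qed

section \<open>The simplex tile\<close>

lemma finite_corner: "finite corner"
  by (simp add: corner_def)

lemma sum_corner: "(\<Sum>v\<in>(corner :: (int ^ 'n::finite) set). g v) = g 0 + (\<Sum>i\<in>UNIV. g (axis i 1))"
proof -
  have "inj (\<lambda>i::'n. axis i (1::int))" by (auto simp: inj_def axis_eq_axis)
  moreover have "(0 :: int ^ 'n) \<notin> range (\<lambda>i. axis i 1)"
    by (metis axis_eq_0_iff imageE zero_neq_one)
  ultimately show ?thesis
    by (simp add: corner_def sum.reindex)
qed

lemma card_corner: "card (corner :: (int ^ 'n::finite) set) = Suc CARD('n)"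
  using sum_corner[of "\<lambda>_ :: int ^ 'n. 1::nat"] by simp

lemma prod_lvar: "(\<Prod>i\<in>I. lvar i) = lmonom (\<chi> i. of_bool (i \<in> I))"
proof -
  have "(\<Sum>i\<in>I. axis i (1::int)) = (\<chi> i. of_bool (i \<in> I))"
    by (simp add: vec_eq_iff axis_def of_bool_def)
  then show ?thesis by (simp add: lvar_def lmonom_sum[symmetric])
qed

text \<open>Passing to complements: the monomial of \<open>I\<close> is the product of all variables
  times the inverses of those outside \<open>I\<close>.\<close>

lemma elem_sym_eq_esym_inverse:
  assumes "k \<le> CARD('n::finite)"
  shows "elem_sym k
    = lmonom (\<chi> i. 1) * esym (\<lambda>i::'n. lmonom (- axis i 1)) UNIV (CARD('n) - k)"
proof -
  have "(elem_sym k :: 'n laurent)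
      = (\<Sum>I | card I = CARD('n) - k. lmonom (\<chi> i. 1) * (\<Prod>i\<in>I. lmonom (- axis i 1)))"
    unfolding elem_sym_def
  proof (rule sum.reindex_bij_witness[of _ uminus uminus])
    fix I :: "'n set"
    have ones: "lmonom (\<chi> i. 1) = (\<Prod>i\<in>I. lvar i) * (\<Prod>i\<in>-I. lvar i)"
      using prod_lvar[of UNIV, symmetric] by (subst prod.union_disjoint[symmetric]) auto
    have "(\<Prod>i\<in>-I. lvar i) * (\<Prod>i\<in>-I. lmonom (- axis i 1)) = 1"
      by (simp add: lvar_def lmonom_0 flip: prod.distrib lmonom_add)
    then show "lmonom (\<chi> i. 1) * (\<Prod>i\<in>-I. lmonom (- axis i 1)) = (\<Prod>i\<in>I. lvar i)"
      by (simp only: ones mult.assoc mult_1_right)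
  qed (use assms in \<open>auto simp: Compl_eq_Diff_UNIV card_Diff_subset\<close>)
  then show ?thesis by (simp add: esym_def sum_distrib_left)
qed

lemma zero_one_vectors_eq_image:
  "{l \<in> L. (\<forall>i. l $ i \<in> {0, 1}) \<and> card {i. l $ i = 1} = k}
    = (\<lambda>I. \<chi> i. of_bool (i \<in> I)) ` {I. card I = k \<and> (\<chi> i. of_bool (i \<in> I)) \<in> L}"
  for L :: "(int ^ 'n::finite) set"
proof (intro equalityI subsetI)
  fix l :: "int ^ 'n" assume l: "l \<in> {l \<in> L. (\<forall>i. l $ i \<in> {0, 1}) \<and> card {i. l $ i = 1} = k}"
  have "l = (\<chi> i. of_bool (i \<in> {i. l $ i = 1}))"
    using l by (auto simp: vec_eq_iff)
  then show "l \<in> (\<lambda>I. \<chi> i. of_bool (i \<in> I)) ` {I. card I = k \<and> (\<chi> i. of_bool (i \<in> I)) \<in> L}"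
    using l by (intro image_eqI[of _ _ "{i. l $ i = 1}"]) auto
qed auto

text \<open>Links the two forms of the theorem: the monomials of \<open>elem_sym k\<close> have the
  indicator vectors of the \<open>k\<close>-sets as exponents.\<close>

lemma elem_sym_eq_card:
  fixes L :: "(int ^ 'n::finite) set"
  assumes "Z_linear T" and T: "\<And>a. T (lmonom a) = (if a \<in> L then 1 else 0)"
  shows "T (elem_sym k) = int (card {l \<in> L. (\<forall>i. l $ i \<in> {0, 1}) \<and> card {i. l $ i = 1} = k})"
proof -
  have inj: "inj (\<lambda>I. (\<chi> i. of_bool (i \<in> I)) :: int ^ 'n)"
    by (auto simp: inj_def vec_eq_iff)
  have "T (elem_sym k) = (\<Sum>I | card I = k. if (\<chi> i. of_bool (i \<in> I)) \<in> L then 1 else 0)"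
    by (simp add: elem_sym_def Z_linear_sum[OF assms(1)] prod_lvar T)
  also have "\<dots> = int (card {I. card I = k \<and> (\<chi> i. of_bool (i \<in> I)) \<in> L})"
    by (simp add: sum.If_cases Int_def)
  also have "card {I. card I = k \<and> (\<chi> i. of_bool (i \<in> I)) \<in> L}
      = card {l \<in> L. (\<forall>i. l $ i \<in> {0, 1}) \<and> card {i. l $ i = 1} = k}"
    unfolding zero_one_vectors_eq_image
    by (rule card_image[symmetric]) (rule inj_on_subset[OF inj], simp)
  finally show ?thesis .
qed

lemma Z_linear_elem_sym_const:
  assumes "Z_linear T" and T: "\<And>a. T (lmonom a) = 1"
  shows "T (elem_sym k :: 'n::finite laurent) = int (CARD('n) choose k)"
  using n_subsets[of "UNIV :: 'n set" k]
  by (simp add: elem_sym_def Z_linear_sum[OF assms(1)] prod_lvar T)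

theorem theorem24:
  fixes p k :: nat
    and L :: "(int ^ 'n::finite) set"
    and T :: "'n laurent \<Rightarrow> int"
  assumes "prime p"
    and "CARD('n) = p - 1"
    and "tiling corner L"
    and "Z_linear T"
    and "\<And>a. T (lmonom a) = (if a \<in> L then 1 else 0)"
    and "k < p"
  shows "(of_int (T (elem_sym k)) :: rat) =
           (of_nat ((p - 1) choose k) - (-1) ^ k) / of_nat p + (-1) ^ k * of_int (T 1)
       \<and> (of_nat (card {l \<in> L. (\<forall>i. l $ i \<in> {0, 1}) \<and> card {i. l $ i = 1} = k}) :: rat) =
           (if 0 \<in> L
            then 1 / of_nat p * (of_nat ((p - 1) choose k) + (of_nat p - 1) * (-1) ^ k)
            else 1 / of_nat p * (of_nat ((p - 1) choose k) - (-1) ^ k))"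
proof -
  \<comment> \<open>\<open>aug\<close> is evaluation with all variables set to 1, obtained as the
    functional of the full lattice.\<close>
  obtain aug :: "'n laurent \<Rightarrow> int" where aug: "Z_linear aug" "\<And>a. aug (lmonom a) = 1"
    using ex_Z_linear[of UNIV] by auto
  have p: "p > 0" using assms(6) by simp
  define y where "y i = lmonom (- axis i 1)" for i :: 'n
  define U where "U g = int p * T g - aug g" for g
  have U_add: "U (g + h) = U g + U h" for g h
    by (simp add: U_def Z_linear_add[OF assms(4)] Z_linear_add[OF aug(1)] algebra_simps)
  interpret U: additive U by unfold_locales (rule U_add)
  have U_pow: "U (g * (1 + (\<Sum>i\<in>UNIV. y i ^ j))) = 0" if j: "0 < j" "j \<le> p - 1" for g j
  proof (induction g rule: laurent_induct)
    case (lmonom a)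
    \<comment> \<open>The vertex 0 of the simplex contributes the summand 1.\<close>
    have f: "(\<Sum>v\<in>corner. lmonom (- v) ^ j) = 1 + (\<Sum>i\<in>UNIV. y i ^ j)"
      by (simp add: sum_corner y_def lmonom_0)
    have card: "card (corner :: (int ^ 'n) set) = p"
      using p assms(2) by (simp add: card_corner)
    have "\<not> p dvd j"
      using j p by (auto dest: dvd_imp_le)
    then have "coprime j (card (corner :: (int ^ 'n) set))"
      using assms(1) by (simp add: card coprime_commute[of j] prime_imp_coprime)
    then have "T (lmonom a * (1 + (\<Sum>i\<in>UNIV. y i ^ j))) = 1"
      using tiling_lmonom_sum_power[OF finite_corner assms(3-5) j(1)] by (simp add: f)
    moreover have "aug (lmonom a * (\<Sum>v\<in>corner. lmonom (- v) ^ j)) = int p"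
      by (simp add: sum_distrib_left Z_linear_sum[OF aug(1)] lmonom_power aug(2) card
          flip: lmonom_add)
    ultimately show ?case by (simp add: U_def f)
  qed (simp_all add: U.zero U.diff left_diff_distrib)
  have U_elem_sym: "U (elem_sym m) = (-1) ^ (p - 1 - m) * U (lmonom (\<chi> i. 1))" if "m \<le> p - 1" for m
  proof -
    have "U (lmonom (\<chi> i. 1) * esym y UNIV (p - 1 - m)) = (-1) ^ (p - 1 - m) * U (lmonom (\<chi> i. 1))"
      by (rule additive_esym_eq[where n = "p - 1"]) (auto intro: U_add U_pow)
    then show ?thesis
      using elem_sym_eq_esym_inverse[where 'n = 'n, of m] that assms(2)
      by (simp add: y_def[abs_def])
  qed
  have "U (elem_sym k) = (-1) ^ (p - 1 - k) * U (lmonom (\<chi> i. 1))"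
    using assms(6) by (intro U_elem_sym) auto
  also have "(-1) ^ (p - 1 - k) = (-1) ^ k * (-1 :: int) ^ (p - 1)"
    using assms(6) by (simp add: minus_one_power_iff)
  \<comment> \<open>The case \<open>m = 0\<close> of \<open>U_elem_sym\<close> compares the product
    of all variables with 1 and absorbs the remaining sign.\<close>
  also have "\<dots> * U (lmonom (\<chi> i. 1)) = (-1) ^ k * U 1"
  proof -
    have "(elem_sym 0 :: 'n laurent) = 1"
      by (simp add: elem_sym_def)
    then show ?thesis using U_elem_sym[of 0] by simp
  qed
  finally have "int p * T (elem_sym k) - int ((p - 1) choose k) = (-1) ^ k * (int p * T 1 - 1)"
    using Z_linear_elem_sym_const[OF aug] aug(2)[of 0] assms(2) by (simp add: U_def lmonom_0)
  then have "of_int (int p * T (elem_sym k) - int ((p - 1) choose k))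
      = (of_int ((-1) ^ k * (int p * T 1 - 1)) :: rat)"
    by (simp only:)
  then have main: "(of_int (T (elem_sym k)) :: rat) =
      (of_nat ((p - 1) choose k) - (-1) ^ k) / of_nat p + (-1) ^ k * of_int (T 1)"
    using p by (simp add: field_simps)
  moreover have "T 1 = (if 0 \<in> L then 1 else 0)"
    using assms(5)[of 0] by (simp add: lmonom_0)
  moreover have "(of_nat (card {l \<in> L. (\<forall>i. l $ i \<in> {0, 1}) \<and> card {i. l $ i = 1} = k}) :: rat)
      = of_int (T (elem_sym k))"
    by (simp only: elem_sym_eq_card[OF assms(4,5)] of_int_of_nat_eq)
  ultimately show ?thesis
    using p by (simp add: field_simps)
qed

end
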